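(* Let $R>0$ and let $a(x),b(x),c(x)$ be real analytic functions defined for $|x|<R$ (given by power series convergent there). Consider the equation $$L(y):=x^3y'''+x^2a(x)y''+xb(x)y'+c(x)y=0 .\qquad( * )$$ Let $r_1,r_2,r_3$ be the roots of the indicial polynomial $$q(r)=r(r-1)(r-2)+r(r-1)a(0)+rb(0)+c(0),$$ ordered so that $\mathrm{Re}(r_1)\ge \mathrm{Re}(r_2)\ge \mathrm{Re}(r_3)$. Then for $0<|x|<R$ there is a solution $\varphi_1$ of $( * )$ given by $$\varphi_1(x)=|x|^{r_1}\sum_{n=0}^\infty d_nx^n,\qquad d_0=1,$$ where the series converges for $|x|<R$. Moreover, if $r_1-r_2\notin\mathbb Z_0^+$, $r_1-r_3\notin\mathbb Z_0^+$ and $r_2-r_3\notin\mathbb Z_0^+$, then there exist two other linearly independent solutions $\varphi_2,\varphi_3$ defined in $0<|x|<R$, given by $$\varphi_2(x)=|x|^{r_2}\sum_{n=0}^\infty\tilde d_nx^n,\quad \tilde d_0=1,\qquad \varphi_3(x)=|x|^{r_3}\sum_{n=0}^\infty\hat d_nx^n,\quad \hat d_0=1,$$ where the series converge for $|x|<R$. The coefficients $d_n,\tilde d_n,\hat d_n$ can be obtained by substituting the solutions in equation $( * )$.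
   Context: $\mathbb Z_0^+$ denotes the set of non-negative integers. The roots $r_j$ and the coefficients of the series may be complex; solutions are allowed to be complex valued. *)

theory Defs
  imports "HOL-Analysis.Analysis" "HOL-Computational_Algebra.Computational_Algebra"
begin

definition has_power_series_on :: "real \<Rightarrow> (real \<Rightarrow> real) \<Rightarrow> (nat \<Rightarrow> real) \<Rightarrow> bool" where
  "has_power_series_on R f \<alpha> \<longleftrightarrow> (\<forall>x. \<bar>x\<bar> < R \<longrightarrow> (\<lambda>n. \<alpha> n * x ^ n) sums f x)"

definition indicial_poly ::
    "(real \<Rightarrow> real) \<Rightarrow> (real \<Rightarrow> real) \<Rightarrow> (real \<Rightarrow> real) \<Rightarrow> complex poly" where
  "indicial_poly a b c =
     [:0, 1:] * [:-1, 1:] * [:-2, 1:]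
     + smult (of_real (a 0)) ([:0, 1:] * [:-1, 1:])
     + smult (of_real (b 0)) [:0, 1:]
     + [:of_real (c 0):]"

definition punctured :: "real \<Rightarrow> real set" where
  "punctured R = {x. 0 < \<bar>x\<bar> \<and> \<bar>x\<bar> < R}"

(* Complex-valued classical solutions of x^3 y''' + x^2 a y'' + x b y' + c y = 0
   on 0 < |x| < R; y1, y2, y3 are the successive derivatives of y there. *)
definition is_solution ::
    "real \<Rightarrow> (real \<Rightarrow> real) \<Rightarrow> (real \<Rightarrow> real) \<Rightarrow> (real \<Rightarrow> real) \<Rightarrow> (real \<Rightarrow> complex) \<Rightarrow> bool" where
  "is_solution R a b c y \<longleftrightarrow>
     (\<exists>y1 y2 y3. \<forall>x \<in> punctured R.
        (y has_vector_derivative y1 x) (at x) \<and>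
        (y1 has_vector_derivative y2 x) (at x) \<and>
        (y2 has_vector_derivative y3 x) (at x) \<and>
        of_real (x ^ 3) * y3 x + of_real (x ^ 2 * a x) * y2 x
          + of_real (x * b x) * y1 x + of_real (c x) * y x = 0)"

definition frobenius_fun :: "complex \<Rightarrow> (nat \<Rightarrow> complex) \<Rightarrow> real \<Rightarrow> complex" where
  "frobenius_fun r d x = of_real \<bar>x\<bar> powr r * (\<Sum>n. d n * of_real x ^ n)"

(* For x \<noteq> 0, both signs included, x^k times the k-th derivative of |x|^r x^n is
   (r + n) (r + n - 1) ... (r + n - k + 1) |x|^r x^n. Hence this is the formal power series
   multiplying |x|^r when y = |x|^r (sum of d n x^n) is substituted into the left-hand side of
   the equation, with \<alpha>, \<beta>, \<gamma> the coefficient sequences of a, b, c. *)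
definition formal_substitution ::
    "(nat \<Rightarrow> real) \<Rightarrow> (nat \<Rightarrow> real) \<Rightarrow> (nat \<Rightarrow> real) \<Rightarrow> complex \<Rightarrow> (nat \<Rightarrow> complex) \<Rightarrow> complex fps" where
  "formal_substitution \<alpha> \<beta> \<gamma> r d =
     Abs_fps (\<lambda>n. (r + of_nat n) * (r + of_nat n - 1) * (r + of_nat n - 2) * d n)
     + Abs_fps (\<lambda>n. of_real (\<alpha> n)) * Abs_fps (\<lambda>n. (r + of_nat n) * (r + of_nat n - 1) * d n)
     + Abs_fps (\<lambda>n. of_real (\<beta> n)) * Abs_fps (\<lambda>n. (r + of_nat n) * d n)
     + Abs_fps (\<lambda>n. of_real (\<gamma> n)) * Abs_fps d"

(* Substitution into the equation holds for d and, given d 0 = 1, for no other sequence. *)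
definition obtained_by_substitution ::
    "(nat \<Rightarrow> real) \<Rightarrow> (nat \<Rightarrow> real) \<Rightarrow> (nat \<Rightarrow> real) \<Rightarrow> complex \<Rightarrow> (nat \<Rightarrow> complex) \<Rightarrow> bool" where
  "obtained_by_substitution \<alpha> \<beta> \<gamma> r d \<longleftrightarrow>
     (\<forall>e. e 0 = 1 \<longrightarrow> (formal_substitution \<alpha> \<beta> \<gamma> r e = 0 \<longleftrightarrow> e = d))"

definition linearly_independent3_on ::
    "'a set \<Rightarrow> ('a \<Rightarrow> complex) \<Rightarrow> ('a \<Rightarrow> complex) \<Rightarrow> ('a \<Rightarrow> complex) \<Rightarrow> bool" where
  "linearly_independent3_on S f g h \<longleftrightarrow>
     (\<forall>u v w :: complex. (\<forall>x\<in>S. u * f x + v * g x + w * h x = 0) \<longrightarrow> u = 0 \<and> v = 0 \<and> w = 0)"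

end

theory Submission
  imports Defs
begin

text \<open>Substituting \<open>|x|^r\<close> times a power series gives the recursion
\<open>q(r + n) d\<^sub>n = - (linear combination of d\<^sub>0, ..., d\<^sub>n\<^sub>-\<^sub>1)\<close>. The order of the real parts and
the non-resonance conditions make \<open>q(r + n)\<close> nonzero for all \<open>n > 0\<close>, so the coefficients exist
and are unique. Cauchy estimates bound the coefficients of the combination by
\<open>M n\<^sup>2 / \<rho>^(n - k)\<close>; as \<open>q(r + n)\<close> grows like \<open>n\<^sup>3\<close>, the sequence \<open>|d\<^sub>n| \<sigma>^n\<close> is bounded by
the maximum over an initial segment for every \<open>\<sigma> < R\<close>.

For independence, apply \<open>x d/dx\<close> twice to a linear relation. The resulting 3 by 3 system has a
determinant that is a continuous function of \<open>x\<close> and at \<open>x = 0\<close> is the Vandermonde determinant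
of the three exponents. No asymptotics of \<open>|x|^r\<close> are needed, so exponents with equal real
parts cause no difficulty.\<close>

section \<open>Convergence of sequences given by a linear recursion\<close>

text \<open>After weighting \<open>d k\<close> with \<open>\<sigma> ^ k\<close>, the right-hand side
  of the recursion becomes a sum with geometric weights
  \<open>(\<sigma> / \<rho>) ^ (n - k)\<close>. Their total is bounded in \<open>n\<close>, so the
  remaining factor \<open>n^2\<close> loses against \<open>Q n\<close>.\<close>

lemma conv_radius_recursion:
  fixes Q d :: "nat \<Rightarrow> complex" and T :: "nat \<Rightarrow> nat \<Rightarrow> complex" and R :: real
  assumes rec: "\<And>n. n > 0 \<Longrightarrow> Q n * d n = - (\<Sum>k<n. T n k * d k)"
    and growth: "filterlim (\<lambda>n. norm (Q n) / real n ^ 2) at_top sequentially"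
    and T: "\<And>\<rho>. 0 < \<rho> \<Longrightarrow> \<rho> < R \<Longrightarrow>
              \<exists>M. \<forall>n. \<forall>k<n. norm (T n k) \<le> M * real n ^ 2 / \<rho> ^ (n - k)"
  shows "ereal R \<le> conv_radius d"
proof (rule conv_radius_geI_ex')
  fix s :: real assume s: "0 < s" "ereal s < ereal R"
  \<comment> \<open>Two intermediate radii, s < \<sigma> < \<rho> < R: the gap between \<sigma> and
    \<rho> makes the weights geometric, the gap between s and \<sigma> turns boundedness at \<sigma>
    into convergence at s.\<close>
  define \<sigma> where "\<sigma> = (s + R) / 2"
  define \<rho> where "\<rho> = (\<sigma> + R) / 2"
  have \<sigma>: "0 < \<sigma>" "s < \<sigma>" and \<rho>: "\<sigma> < \<rho>" "0 < \<rho>" "\<rho> < R"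
    using s by (auto simp: \<sigma>_def \<rho>_def field_simps)
  obtain M where M: "\<And>n k. k < n \<Longrightarrow> norm (T n k) \<le> M * real n ^ 2 / \<rho> ^ (n - k)"
    using T[OF \<rho>(2,3)] by blast
  define t where "t = \<sigma> / \<rho>"
  have t: "0 < t" "t < 1" using \<sigma> \<rho> by (auto simp: t_def)
  define D where "D = (\<lambda>n. norm (d n) * \<sigma> ^ n)"
  have D0: "D n \<ge> 0" for n using \<sigma> by (auto simp: D_def)
  \<comment> \<open>The growth of \<open>norm (Q n) / n^2\<close> that the induction step below
    requires. The sign of \<open>M\<close> is unknown; \<open>\<bar>M\<bar> + 1\<close> makes
    \<open>K\<close> positive.\<close>
  define K where "K = (\<bar>M\<bar> + 1) / (1 - t)"
  have K: "K > 0" using t by (auto simp: K_def)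
  have geom: "(\<Sum>k<n. t ^ (n - k)) \<le> 1 / (1 - t)" for n
  proof -
    have "(\<Sum>k<n. t ^ (n - k)) = (\<Sum>k<n. t ^ Suc k)"
      by (rule sum.reindex_bij_witness[of _ "\<lambda>k. n - Suc k" "\<lambda>k. n - Suc k"])
         (auto simp: Suc_diff_Suc)
    also have "\<dots> \<le> (\<Sum>k<n. t ^ k)"
      using t by (intro sum_mono power_decreasing) auto
    also have "\<dots> \<le> (\<Sum>k. t ^ k)"
      using t by (intro sum_le_suminf) (auto simp: summable_geometric)
    also have "\<dots> = 1 / (1 - t)" using t by (simp add: suminf_geometric)
    finally show ?thesis .
  qed
  have "eventually (\<lambda>n. norm (Q n) / real n ^ 2 \<ge> K) sequentially"
    using growth unfolding filterlim_at_top by blast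
  then obtain N' where N': "\<And>n. n \<ge> N' \<Longrightarrow> norm (Q n) / real n ^ 2 \<ge> K"
    unfolding eventually_sequentially by blast
  \<comment> \<open>The successor excludes \<open>n = 0\<close>, where the recursion is not
    assumed.\<close>
  define N where "N = Suc N'"
  have N: "N > 0" "\<And>n. n \<ge> N \<Longrightarrow> norm (Q n) / real n ^ 2 \<ge> K"
    using N' by (auto simp: N_def)
  \<comment> \<open>As the terms are nonnegative, the sum dominates each of the first
    \<open>N\<close> of them; strong induction carries the bound to all \<open>n\<close>.\<close>
  define B where "B = (\<Sum>k<N. D k)"
  have B0: "B \<ge> 0" unfolding B_def by (intro sum_nonneg) (auto simp: D0)
  have "D n \<le> B" for n
  proof (induction n rule: less_induct)
    case (less n)
    show ?case
    proof (cases "n < N")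
      case True
      then show ?thesis unfolding B_def
        by (intro member_le_sum) (auto simp: D0)
    next
      case False
      have n: "n > 0" using False N(1) by auto
      have Qn: "norm (Q n) \<ge> K * real n ^ 2"
        using N(2)[of n] False n by (simp add: field_simps)
      have Qpos: "norm (Q n) > 0"
        by (rule less_le_trans[OF _ Qn]) (use K n in auto)
      have term_le: "norm (T n k) * norm (d k) * \<sigma> ^ n \<le> \<bar>M\<bar> * real n ^ 2 * B * t ^ (n - k)"
        if "k < n" for k
      proof -
        \<comment> \<open>Splitting \<sigma>^n into \<sigma>^(n-k) \<sigma>^k leaves
          \<open>D k\<close> for the induction hypothesis and pairs \<sigma>^(n-k) with
          \<rho>^(n-k).\<close>
        have "norm (T n k) * norm (d k) * \<sigma> ^ n = norm (T n k) * \<sigma> ^ (n - k) * D k"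
          using that by (simp add: D_def flip: power_add)
        also have "\<dots> \<le> (M * real n ^ 2 / \<rho> ^ (n - k)) * \<sigma> ^ (n - k) * D k"
          by (intro mult_right_mono M that D0) (use \<sigma> in auto)
        also have "\<dots> = M * real n ^ 2 * t ^ (n - k) * D k"
          by (simp add: t_def power_divide)
        also have "\<dots> \<le> \<bar>M\<bar> * real n ^ 2 * t ^ (n - k) * B"
          using t by (intro mult_mono less.IH that D0) auto
        finally show ?thesis by (simp add: mult_ac)
      qed
      have "norm (Q n) * D n = norm (\<Sum>k<n. T n k * d k) * \<sigma> ^ n"
        using arg_cong[OF rec[OF n], of norm] by (simp add: D_def norm_mult)
      also have "\<dots> \<le> (\<Sum>k<n. norm (T n k) * norm (d k)) * \<sigma> ^ n"
        using \<sigma> by (intro mult_right_mono sum_norm_le) (auto simp: norm_mult)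
      also have "\<dots> \<le> (\<Sum>k<n. \<bar>M\<bar> * real n ^ 2 * B * t ^ (n - k))"
        unfolding sum_distrib_right by (intro sum_mono term_le) auto
      also have "\<dots> = \<bar>M\<bar> * real n ^ 2 * B * (\<Sum>k<n. t ^ (n - k))"
        by (simp add: sum_distrib_left)
      also have "\<dots> \<le> \<bar>M\<bar> * real n ^ 2 * B * (1 / (1 - t))"
        by (intro mult_left_mono geom) (use B0 in auto)
      also have "\<dots> \<le> (\<bar>M\<bar> + 1) * real n ^ 2 * B * (1 / (1 - t))"
        using t B0 by (intro mult_right_mono) auto
      also have "\<dots> = (K * real n ^ 2) * B"
        by (simp add: K_def)
      also have "\<dots> \<le> norm (Q n) * B"
        by (intro mult_right_mono Qn B0)
      finally show ?thesis using Qpos by simp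
    qed
  qed
  then have "summable (\<lambda>n. norm (d n) * s ^ n)"
    using s \<sigma> by (intro Abel_lemma[where ?r0.0 = \<sigma> and M = B]) (auto simp: D_def)
  then show "summable (\<lambda>n. d n * of_real s ^ n)"
    using s by (intro summable_norm_cancel[of "\<lambda>n. d n * of_real s ^ n"])
      (simp add: norm_mult norm_power)
qed

section \<open>Real power series: coefficient bounds and complex formal series\<close>

text \<open>The terms of the series at \<rho> tend to zero, hence are bounded; this already gives
  the Cauchy estimates.\<close>

lemma powser_bound:
  fixes \<alpha> :: "nat \<Rightarrow> real"
  assumes "has_power_series_on R a \<alpha>" "0 < \<rho>" "\<rho> < R"
  shows "\<exists>M. \<forall>j. \<bar>\<alpha> j\<bar> \<le> M / \<rho> ^ j"
proof -
  have "summable (\<lambda>n. \<alpha> n * \<rho> ^ n)"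
    using assms unfolding has_power_series_on_def by (intro sums_summable[of _ "a \<rho>"]) auto
  then have "Bseq (\<lambda>n. \<alpha> n * \<rho> ^ n)"
    by (intro convergent_imp_Bseq convergentI[OF summable_LIMSEQ_zero])
  then obtain M where "\<forall>n. norm (\<alpha> n * \<rho> ^ n) \<le> M"
    unfolding Bseq_def by blast
  then have "\<bar>\<alpha> j\<bar> \<le> M / \<rho> ^ j" for j
    using assms(2) by (simp add: abs_mult pos_le_divide_eq)
  then show ?thesis by blast
qed

lemma powser_fps:
  assumes "has_power_series_on R a \<alpha>"
  shows "ereal R \<le> fps_conv_radius (Abs_fps (\<lambda>n. complex_of_real (\<alpha> n)))"
    and "\<bar>x\<bar> < R \<Longrightarrow> eval_fps (Abs_fps (\<lambda>n. complex_of_real (\<alpha> n))) (of_real x) = of_real (a x)"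
proof -
  have s: "(\<lambda>n. complex_of_real (\<alpha> n) * of_real x ^ n) sums of_real (a x)" if "\<bar>x\<bar> < R" for x
  proof -
    have "(\<lambda>n. complex_of_real (\<alpha> n * x ^ n)) sums of_real (a x)"
      using assms that unfolding has_power_series_on_def by (subst sums_of_real_iff) auto
    then show ?thesis by simp
  qed
  show "ereal R \<le> fps_conv_radius (Abs_fps (\<lambda>n. complex_of_real (\<alpha> n)))"
    unfolding fps_conv_radius_def
    by (rule conv_radius_geI_ex') (simp, rule sums_summable[OF s], simp)
  show "eval_fps (Abs_fps (\<lambda>n. complex_of_real (\<alpha> n))) (of_real x) = of_real (a x)" if "\<bar>x\<bar> < R"
    using s[OF that] by (simp add: eval_fps_def sums_iff)
qed

section \<open>The Euler operator and derivatives of Frobenius functions\<close>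

text \<open>The operator \<open>x d/dx\<close> in terms of coefficients, when \<open>s\<close> is the exponent of the
prefactor \<open>|x|^s\<close>.\<close>
definition euler :: "complex \<Rightarrow> (nat \<Rightarrow> complex) \<Rightarrow> nat \<Rightarrow> complex" where
  "euler s d n = (s + of_nat n) * d n"

lemma euler_fps:
  "Abs_fps (euler s d) = fps_const s * Abs_fps d + fps_X * fps_deriv (Abs_fps d)"
  by (rule fps_ext) (auto simp: euler_def algebra_simps gr0_conv_Suc)

lemma euler_conv_radius:
  assumes "ereal R \<le> fps_conv_radius (Abs_fps d)"
  shows "ereal R \<le> fps_conv_radius (Abs_fps (euler s d))"
proof -
  have "ereal R \<le> fps_conv_radius (fps_deriv (Abs_fps d))"
    using assms fps_conv_radius_deriv order_trans by blast
  then have "ereal R \<le> fps_conv_radius (fps_const s * Abs_fps d)"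
    "ereal R \<le> fps_conv_radius (fps_X * fps_deriv (Abs_fps d))"
    using assms by (auto intro!: order_trans[OF _ fps_conv_radius_mult])
  then show ?thesis
    unfolding euler_fps by (intro order_trans[OF _ fps_conv_radius_add]) auto
qed

lemma eval_fps_euler:
  assumes "ereal (norm z) < fps_conv_radius (Abs_fps d)"
  shows "eval_fps (Abs_fps (euler s d)) z =
           s * eval_fps (Abs_fps d) z + z * eval_fps (fps_deriv (Abs_fps d)) z"
proof -
  have *: "ereal (norm z) < fps_conv_radius (fps_deriv (Abs_fps d))"
    using assms fps_conv_radius_deriv less_le_trans by blast
  have "ereal (norm z) < fps_conv_radius (fps_const s * Abs_fps d)"
    "ereal (norm z) < fps_conv_radius (fps_X * fps_deriv (Abs_fps d))"
    using assms * by (auto intro!: less_le_trans[OF _ fps_conv_radius_mult])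
  then show ?thesis using assms *
    by (simp add: euler_fps eval_fps_add eval_fps_mult)
qed

lemma frobenius_fun_eval_fps:
  "frobenius_fun r d x = of_real \<bar>x\<bar> powr r * eval_fps (Abs_fps d) (of_real x)"
  by (simp add: frobenius_fun_def eval_fps_def)

text \<open>Differentiating the factor x^(-k) lowers the exponent of the Euler operator by
  \<open>k\<close>. The cases k = 0, 1, 2 give the three successive derivatives of a Frobenius
  function.\<close>

lemma frobenius_fun_has_vector_derivative:
  fixes x :: real
  assumes x: "x \<noteq> 0" "ereal \<bar>x\<bar> < fps_conv_radius (Abs_fps d)"
  shows "((\<lambda>x. frobenius_fun r d x / of_real x ^ k) has_vector_derivative
            frobenius_fun r (euler (r - of_nat k) d) x / of_real x ^ Suc k) (at x)"
proof -
  \<comment> \<open>With the constant sign \<open>s\<close>, \<open>\<bar>x\<bar>\<close> becomes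
    \<open>s * x\<close>, and z -> (s z)^r is holomorphic near \<open>x\<close> because s x > 0 is
    off the branch cut. Both signs of \<open>x\<close> are treated at once.\<close>
  define s where "s = sgn x"
  have s: "s \<noteq> 0" "s * s = 1" "s * x = \<bar>x\<bar>" using x by (auto simp: s_def sgn_if)
  have sx: "complex_of_real s * of_real x = of_real \<bar>x\<bar>" using s by (metis of_real_mult)
  let ?F = "Abs_fps d"
  let ?G = "\<lambda>z. (of_real s * z) powr r * eval_fps ?F z / z ^ k"
  have F: "(eval_fps ?F has_field_derivative eval_fps (fps_deriv ?F) (of_real x)) (at (of_real x))"
    by (rule has_field_derivative_eval_fps) (use x in auto)
  have P: "((\<lambda>z. (of_real s * z) powr r) has_field_derivative
             r * of_real \<bar>x\<bar> powr r / of_real x) (at (of_real x))"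
  proof -
    have "((\<lambda>z. (of_real s * z) powr r) has_field_derivative
             r * (of_real s * of_real x) powr (r - 1) * of_real s) (at (of_real x))"
      by (auto intro!: derivative_eq_intros simp: sx x)
    also have "r * (of_real s * of_real x) powr (r - 1) * of_real s =
          r * of_real \<bar>x\<bar> powr r / complex_of_real x"
      using x by (simp add: sx powr_diff field_simps)
    finally show ?thesis .
  qed
  have "(?G has_field_derivative
     ((r * of_real \<bar>x\<bar> powr r / of_real x * eval_fps ?F (of_real x)
        + eval_fps (fps_deriv ?F) (of_real x) * of_real \<bar>x\<bar> powr r) * of_real x ^ k
       - of_real \<bar>x\<bar> powr r * eval_fps ?F (of_real x) * (of_nat k * of_real x ^ (k - 1)))
       / (of_real x ^ k * of_real x ^ k)) (at (of_real x))" (is "(_ has_field_derivative ?D) _")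
    using DERIV_divide[OF DERIV_mult[OF P F] DERIV_power[OF DERIV_ident]] x
    by (simp add: sx mult_ac)
  \<comment> \<open>The case split settles the exponent \<open>k - 1\<close>, a truncated
    subtraction at \<open>k = 0\<close>.\<close>
  moreover have "?D = frobenius_fun r (euler (r - of_nat k) d) x / of_real x ^ Suc k"
    using x by (cases k) (simp_all add: frobenius_fun_eval_fps eval_fps_euler field_simps)
  ultimately have "(?G has_field_derivative
      frobenius_fun r (euler (r - of_nat k) d) x / of_real x ^ Suc k) (at (of_real x))" by simp
  then have D: "((\<lambda>x. ?G (of_real x)) has_vector_derivative
      frobenius_fun r (euler (r - of_nat k) d) x / of_real x ^ Suc k) (at x)"
    by (rule has_vector_derivative_real_field)
  \<comment> \<open>On the half-line containing \<open>x\<close> the sign is constant, so the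
    holomorphic expression agrees with the Frobenius function there.\<close>
  have S: "open (if x > 0 then {0<..} else {..<0::real})"
    "x \<in> (if x > 0 then {0<..} else {..<0::real})" using x by auto
  show ?thesis
  proof (rule has_vector_derivative_transform_within_open[OF D S])
    fix y assume "y \<in> (if x > 0 then {0<..} else {..<0::real})"
    then have "s * y = \<bar>y\<bar>" using x by (auto simp: s_def sgn_if split: if_splits)
    then have "complex_of_real s * of_real y = of_real \<bar>y\<bar>" by (metis of_real_mult)
    then show "?G (of_real y) = frobenius_fun r d y / of_real y ^ k"
      by (simp add: frobenius_fun_eval_fps)
  qed
qed

section \<open>From formal solutions to classical solutions\<close>

text \<open>With E = x d/dx one has x^2 d^2/dx^2 = (E - 1) E and x^3 d^3/dx^3 = (E - 2) (E - 1) E;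
  each shift moves into the exponent.\<close>

lemma formal_substitution_euler:
  "formal_substitution \<alpha> \<beta> \<gamma> r d =
     Abs_fps (euler (r - 2) (euler (r - 1) (euler r d)))
     + Abs_fps (\<lambda>n. of_real (\<alpha> n)) * Abs_fps (euler (r - 1) (euler r d))
     + Abs_fps (\<lambda>n. of_real (\<beta> n)) * Abs_fps (euler r d)
     + Abs_fps (\<lambda>n. of_real (\<gamma> n)) * Abs_fps d"
  unfolding formal_substitution_def
  by (intro arg_cong2[where f = "(+)"] arg_cong2[where f = "(*)"] arg_cong[where f = Abs_fps])
     (auto simp: euler_def fun_eq_iff algebra_simps)

lemma frobenius_is_solution:
  assumes abc: "has_power_series_on R a \<alpha>" "has_power_series_on R b \<beta>" "has_power_series_on R c \<gamma>"
    and R: "ereal R \<le> fps_conv_radius (Abs_fps d)"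
    and formal: "formal_substitution \<alpha> \<beta> \<gamma> r d = 0"
  shows "is_solution R a b c (frobenius_fun r d)"
proof -
  \<comment> \<open>The series of x y', x^2 y'' and x^3 y''' without the prefactor |x|^r; dividing
    by the power of \<open>x\<close> gives the derivatives.\<close>
  define d1 where "d1 = euler r d"
  define d2 where "d2 = euler (r - 1) d1"
  define d3 where "d3 = euler (r - 2) d2"
  have R1: "ereal R \<le> fps_conv_radius (Abs_fps d1)"
    unfolding d1_def by (rule euler_conv_radius[OF R])
  have R2: "ereal R \<le> fps_conv_radius (Abs_fps d2)"
    unfolding d2_def by (rule euler_conv_radius[OF R1])
  have R3: "ereal R \<le> fps_conv_radius (Abs_fps d3)"
    unfolding d3_def by (rule euler_conv_radius[OF R2])
  have sol: "(frobenius_fun r d has_vector_derivative frobenius_fun r d1 x / of_real x) (at x) \<and>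
    ((\<lambda>x. frobenius_fun r d1 x / of_real x) has_vector_derivative
        frobenius_fun r d2 x / of_real x ^ 2) (at x) \<and>
    ((\<lambda>x. frobenius_fun r d2 x / of_real x ^ 2) has_vector_derivative
        frobenius_fun r d3 x / of_real x ^ 3) (at x) \<and>
    of_real (x ^ 3) * (frobenius_fun r d3 x / of_real x ^ 3)
      + of_real (x ^ 2 * a x) * (frobenius_fun r d2 x / of_real x ^ 2)
      + of_real (x * b x) * (frobenius_fun r d1 x / of_real x)
      + of_real (c x) * frobenius_fun r d x = 0" if "x \<in> punctured R" for x
  proof (intro conjI)
    have x: "x \<noteq> 0" "\<bar>x\<bar> < R" using that by (auto simp: punctured_def)
    have less: "ereal \<bar>x\<bar> < fps_conv_radius f" if "ereal R \<le> fps_conv_radius f" for f :: "complex fps"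
      using x that by (intro less_le_trans[OF _ that]) auto
    show "(frobenius_fun r d has_vector_derivative frobenius_fun r d1 x / of_real x) (at x)"
      using frobenius_fun_has_vector_derivative[OF x(1) less[OF R], of r 0] by (simp add: d1_def)
    show "((\<lambda>x. frobenius_fun r d1 x / of_real x) has_vector_derivative
        frobenius_fun r d2 x / of_real x ^ 2) (at x)"
      using frobenius_fun_has_vector_derivative[OF x(1) less[OF R1], of r 1]
      by (simp add: d2_def eval_nat_numeral)
    show "((\<lambda>x. frobenius_fun r d2 x / of_real x ^ 2) has_vector_derivative
        frobenius_fun r d3 x / of_real x ^ 3) (at x)"
      using frobenius_fun_has_vector_derivative[OF x(1) less[OF R2], of r 2]
      by (simp add: d3_def eval_nat_numeral)
    let ?a = "Abs_fps (\<lambda>n. complex_of_real (\<alpha> n))"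
    let ?b = "Abs_fps (\<lambda>n. complex_of_real (\<beta> n))"
    let ?c = "Abs_fps (\<lambda>n. complex_of_real (\<gamma> n))"
    have less': "ereal (norm (complex_of_real x)) < fps_conv_radius f"
      if "ereal R \<le> fps_conv_radius f" for f :: "complex fps"
      using less[OF that] by simp
    note rads = R R1 R2 R3 powser_fps(1)[OF abc(1)] powser_fps(1)[OF abc(2)] powser_fps(1)[OF abc(3)]
    have mul: "ereal R \<le> fps_conv_radius (f * g)"
      if "ereal R \<le> fps_conv_radius f" "ereal R \<le> fps_conv_radius g" for f g :: "complex fps"
      using that by (intro order_trans[OF _ fps_conv_radius_mult]) auto
    have add: "ereal R \<le> fps_conv_radius (f + g)"
      if "ereal R \<le> fps_conv_radius f" "ereal R \<le> fps_conv_radius g" for f g :: "complex fps"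
      using that by (intro order_trans[OF _ fps_conv_radius_add]) auto
    \<comment> \<open>All radii of convergence are at least \<open>R\<close>, so evaluating the
      formal identity at \<open>x\<close> commutes with its sums and products.\<close>
    have "0 = eval_fps (Abs_fps d3 + ?a * Abs_fps d2 + ?b * Abs_fps d1 + ?c * Abs_fps d) (of_real x)"
      using formal by (simp add: formal_substitution_euler d1_def d2_def d3_def)
    also have "\<dots> = eval_fps (Abs_fps d3) (of_real x) + of_real (a x) * eval_fps (Abs_fps d2) (of_real x)
       + of_real (b x) * eval_fps (Abs_fps d1) (of_real x) + of_real (c x) * eval_fps (Abs_fps d) (of_real x)"
      by (simp only: eval_fps_add eval_fps_mult less' mul add rads
          powser_fps(2)[OF abc(1) x(2)] powser_fps(2)[OF abc(2) x(2)] powser_fps(2)[OF abc(3) x(2)])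
    finally have E: "\<dots> = 0" ..
    have "of_real (x ^ 3) * (frobenius_fun r d3 x / of_real x ^ 3)
      + of_real (x ^ 2 * a x) * (frobenius_fun r d2 x / of_real x ^ 2)
      + of_real (x * b x) * (frobenius_fun r d1 x / of_real x)
      + of_real (c x) * frobenius_fun r d x
      = of_real \<bar>x\<bar> powr r * (eval_fps (Abs_fps d3) (of_real x)
       + of_real (a x) * eval_fps (Abs_fps d2) (of_real x)
       + of_real (b x) * eval_fps (Abs_fps d1) (of_real x)
       + of_real (c x) * eval_fps (Abs_fps d) (of_real x))"
      using x by (simp add: frobenius_fun_eval_fps algebra_simps)
    then show "of_real (x ^ 3) * (frobenius_fun r d3 x / of_real x ^ 3)
      + of_real (x ^ 2 * a x) * (frobenius_fun r d2 x / of_real x ^ 2)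
      + of_real (x * b x) * (frobenius_fun r d1 x / of_real x)
      + of_real (c x) * frobenius_fun r d x = 0" by (simp add: E)
  qed
  then show ?thesis unfolding is_solution_def
    by (intro exI[of _ "\<lambda>x. frobenius_fun r d1 x / of_real x"]
        exI[of _ "\<lambda>x. frobenius_fun r d2 x / of_real x ^ 2"]
        exI[of _ "\<lambda>x. frobenius_fun r d3 x / of_real x ^ 3"] ballI) (rule sol)
qed

section \<open>The indicial polynomial and the coefficient recursion\<close>

lemma poly_indicial_poly:
  "poly (indicial_poly a b c) z =
     z * (z - 1) * (z - 2) + of_real (a 0) * (z * (z - 1)) + of_real (b 0) * z + of_real (c 0)"
  by (simp add: indicial_poly_def algebra_simps)

text \<open>A monic complex polynomial is the product of the linear factors over its multiset of
  roots.\<close>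

lemma indicial_poly_factor:
  assumes "proots (indicial_poly a b c) = {#r1, r2, r3#}"
  shows "poly (indicial_poly a b c) z = (z - r1) * (z - r2) * (z - r3)"
proof -
  let ?q = "indicial_poly a b c"
  have c: "coeff ?q 3 = 1" "degree ?q \<le> 3"
    by (auto simp: indicial_poly_def numeral_eq_Suc intro!: degree_add_le)
  then have "lead_coeff ?q = 1"
    by (metis le_degree order_antisym zero_neq_one)
  then have "?q = (\<Prod>x\<in>#proots ?q. [:-x, 1:])"
    using complex_poly_decompose_multiset[of ?q] by simp
  then have "poly ?q z = poly (\<Prod>x\<in>#proots ?q. [:-x, 1:]) z" by simp
  then show ?thesis unfolding assms by (simp add: algebra_simps)
qed

text \<open>The contribution of \<open>d k\<close> to the coefficient of index \<open>n > k\<close>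
  after substitution. The third-order term has leading coefficient x^3 exactly and enters only at
  \<open>k = n\<close>.\<close>

definition frob_term :: "(nat \<Rightarrow> real) \<Rightarrow> (nat \<Rightarrow> real) \<Rightarrow> (nat \<Rightarrow> real) \<Rightarrow> complex \<Rightarrow> nat \<Rightarrow> nat \<Rightarrow> complex"
  where "frob_term \<alpha> \<beta> \<gamma> r n k =
    of_real (\<alpha> (n - k)) * ((r + of_nat k) * (r + of_nat k - 1))
    + of_real (\<beta> (n - k)) * (r + of_nat k) + of_real (\<gamma> (n - k))"

text \<open>Splitting the last index off each Cauchy product: there the zeroth coefficients of
  \<open>a\<close>, \<open>b\<close>, \<open>c\<close> join the third-order term to form the
  indicial polynomial at \<open>r + n\<close>.\<close>

lemma formal_substitution_nth:
  assumes "a 0 = \<alpha> 0" "b 0 = \<beta> 0" "c 0 = \<gamma> 0"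
  shows "fps_nth (formal_substitution \<alpha> \<beta> \<gamma> r e) n =
    poly (indicial_poly a b c) (r + of_nat n) * e n + (\<Sum>k<n. frob_term \<alpha> \<beta> \<gamma> r n k * e k)"
proof -
  have *: "fps_nth (f * g) n = (\<Sum>k<n. fps_nth f (n - k) * fps_nth g k) + fps_nth f 0 * fps_nth g n"
    for f g :: "complex fps"
  proof -
    have "fps_nth (f * g) n = (\<Sum>k=0..n. fps_nth g k * fps_nth f (n - k))"
      by (simp only: mult.commute[of f g] fps_mult_nth)
    then show ?thesis
      by (simp add: atLeast0AtMost mult.commute flip: lessThan_Suc_atMost)
  qed
  show ?thesis unfolding poly_indicial_poly formal_substitution_def assms frob_term_def
    by (simp only: fps_add_nth * fps_nth_Abs_fps)
       (simp add: algebra_simps sum.distrib sum_subtractf)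
qed

lemma frob_term_bound:
  assumes abc: "has_power_series_on R a \<alpha>" "has_power_series_on R b \<beta>" "has_power_series_on R c \<gamma>"
    and \<rho>: "0 < \<rho>" "\<rho> < R"
  shows "\<exists>M. \<forall>n. \<forall>k<n. norm (frob_term \<alpha> \<beta> \<gamma> r n k) \<le> M * real n ^ 2 / \<rho> ^ (n - k)"
proof -
  obtain A B C where ABC: "\<And>j. \<bar>\<alpha> j\<bar> \<le> A / \<rho> ^ j" "\<And>j. \<bar>\<beta> j\<bar> \<le> B / \<rho> ^ j" "\<And>j. \<bar>\<gamma> j\<bar> \<le> C / \<rho> ^ j"
    using powser_bound[OF abc(1) \<rho>] powser_bound[OF abc(2) \<rho>] powser_bound[OF abc(3) \<rho>] by metis
  \<comment> \<open>Chosen so that \<open>norm r + n \<le> s * n\<close> for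
    \<open>n \<ge> 1\<close>; since \<open>k + 1 \<le> n\<close>, both factors \<open>r + k\<close>
    and \<open>r + k - 1\<close> are then at most \<open>s * n\<close> in norm.\<close>
  define s where "s = norm r + 1"
  have s: "s \<ge> 1" by (simp add: s_def)
  have "norm (frob_term \<alpha> \<beta> \<gamma> r n k) \<le> (A + B + C) * s ^ 2 * real n ^ 2 / \<rho> ^ (n - k)"
    if "k < n" for n k
  proof -
    have "norm r + real n \<le> s * real n"
      using that mult_left_mono[of 1 "real n" "norm r"] by (simp add: s_def algebra_simps)
    moreover have "norm (r + of_nat k) \<le> norm r + real k"
      using norm_triangle_ineq[of r "of_nat k"] by simp
    moreover have "norm (r + of_nat k - 1) \<le> norm (r + of_nat k) + 1"
      using norm_triangle_ineq4[of "r + of_nat k" 1] by simp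
    moreover have "real k + 1 \<le> real n" using that by linarith
    ultimately have 1: "norm (r + of_nat k) \<le> s * n" "norm (r + of_nat k - 1) \<le> s * n"
      by linarith+
    \<comment> \<open>From \<open>s * n \<ge> 1\<close>, the terms with one factor or none are also
      bounded by the square.\<close>
    have "1 * 1 \<le> s * real n" using s that by (intro mult_mono) auto
    then have 2: "1 \<le> (s * real n) ^ 2" "s * real n \<le> (s * real n) ^ 2"
      by (auto simp: self_le_power)
    have 3: "norm (r + of_nat k) * norm (r + of_nat k - 1) \<le> (s * real n) ^ 2"
      unfolding power2_eq_square using s by (intro mult_mono 1) auto
    let ?p = "1 / \<rho> ^ (n - k)"
    have "norm (frob_term \<alpha> \<beta> \<gamma> r n k) \<le>
       \<bar>\<alpha> (n - k)\<bar> * (norm (r + of_nat k) * norm (r + of_nat k - 1))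
        + \<bar>\<beta> (n - k)\<bar> * norm (r + of_nat k) + \<bar>\<gamma> (n - k)\<bar> * 1"
      unfolding frob_term_def
      by (intro order_trans[OF norm_triangle_ineq] add_mono) (simp_all add: norm_mult)
    also have "\<dots> \<le> (A / \<rho> ^ (n - k)) * (s * real n) ^ 2 + (B / \<rho> ^ (n - k)) * (s * real n) ^ 2
        + (C / \<rho> ^ (n - k)) * (s * real n) ^ 2"
      using 1 2 3 by (intro add_mono mult_mono ABC order_trans[OF abs_ge_zero ABC(1)]
          order_trans[OF abs_ge_zero ABC(2)] order_trans[OF abs_ge_zero ABC(3)]) auto
    also have "\<dots> = (A + B + C) * s ^ 2 * real n ^ 2 / \<rho> ^ (n - k)"
      by (simp add: power_mult_distrib algebra_simps add_divide_distrib)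
    finally show ?thesis .
  qed
  then show ?thesis by blast
qed

text \<open>Once n > 2 C, each of the three linear factors has norm at least n / 2, so the quotient
  is at least n / 8.\<close>

lemma indicial_growth:
  assumes q: "\<And>z. q z = (z - r1) * (z - r2) * (z - r3 :: complex)"
  shows "filterlim (\<lambda>n. norm (q (r + of_nat n)) / real n ^ 2) at_top sequentially"
proof -
  define C where "C = norm (r - r1) + norm (r - r2) + norm (r - r3)"
  have lin: "real n - C \<le> norm (r + of_nat n - s)" if "norm (r - s) \<le> C" for n s
    using norm_triangle_ineq2[of "of_nat n :: complex" "s - r"] that
    by (simp add: norm_minus_commute algebra_simps)
  have ge: "eventually (\<lambda>n. norm (q (r + of_nat n)) / real n ^ 2 \<ge> real n * (1 / 8)) sequentially"
    using eventually_gt_at_top[of "nat \<lceil>2 * C\<rceil>"]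
  proof eventually_elim
    case (elim n)
    then have n: "real n > 2 * C" "real n > 0" by (auto simp: C_def) linarith
    have l: "real n / 2 \<le> norm (r + of_nat n - s)" if "s \<in> {r1, r2, r3}" for s
      using lin[of s n] that n by (auto simp: C_def)
    have "(real n / 2) * (real n / 2) * (real n / 2) \<le> norm (q (r + of_nat n))"
      unfolding q norm_mult by (intro mult_mono l) auto
    then show ?case using n by (simp add: field_simps power2_eq_square)
  qed
  have "filterlim (\<lambda>n. real n * (1 / 8)) at_top sequentially"
    by (rule filterlim_at_top_mult_tendsto_pos[OF tendsto_const _ filterlim_real_sequentially]) simp
  then show ?thesis by (rule filterlim_at_top_mono[OF _ ge])
qed

section \<open>Existence and uniqueness of the Frobenius series\<close>

text \<open>The recursion solved for its newest coefficient, normalised to 1 at index 0. Dividing by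
  \<open>Q n\<close> is justified later by non-resonance.\<close>

function frob_coeff :: "(nat \<Rightarrow> complex) \<Rightarrow> (nat \<Rightarrow> nat \<Rightarrow> complex) \<Rightarrow> nat \<Rightarrow> complex" where
  "frob_coeff Q T n = (if n = 0 then 1 else - (\<Sum>k<n. T n k * frob_coeff Q T k) / Q n)"
  by auto
termination by (relation "Wellfounded.measure (\<lambda>(Q, T, n). n)") auto

declare frob_coeff.simps [simp del]

text \<open>Coefficient 0 of the substituted equation vanishes because \<open>r\<close> is a root;
  for \<open>n > 0\<close>, non-resonance lets coefficient \<open>n\<close> determine
  \<open>d n\<close>. The lemma serves each of the three exponents.\<close>

lemma frobenius_series:
  assumes abc: "has_power_series_on R a \<alpha>" "has_power_series_on R b \<beta>" "has_power_series_on R c \<gamma>"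
    and R: "R > 0"
    and q: "\<And>z. poly (indicial_poly a b c) z = (z - r1) * (z - r2) * (z - r3)"
    and root: "poly (indicial_poly a b c) r = 0"
    and nonres: "\<And>n. n > 0 \<Longrightarrow> poly (indicial_poly a b c) (r + of_nat n) \<noteq> 0"
  obtains d where "d 0 = 1" "ereal R \<le> fps_conv_radius (Abs_fps d)"
    "is_solution R a b c (frobenius_fun r d)" "obtained_by_substitution \<alpha> \<beta> \<gamma> r d"
proof -
  let ?Q = "\<lambda>n. poly (indicial_poly a b c) (r + of_nat n)"
  let ?T = "frob_term \<alpha> \<beta> \<gamma> r"
  define d where "d = frob_coeff ?Q ?T"
  have d0: "d 0 = 1" by (simp add: d_def frob_coeff.simps)
  have rec: "?Q n * d n = - (\<Sum>k<n. ?T n k * d k)" if "n > 0" for n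
    using nonres[OF that] that unfolding d_def by (subst frob_coeff.simps) simp
  \<comment> \<open>This links the values at 0 in \<open>indicial_poly\<close> to the coefficient
    sequences in \<open>formal_substitution\<close>.\<close>
  have at0: "f 0 = \<phi> 0" if "has_power_series_on R f \<phi>" for f :: "real \<Rightarrow> real" and \<phi>
  proof -
    have "(\<lambda>n. \<phi> n * 0 ^ n) sums f 0" using that[unfolded has_power_series_on_def, rule_format, of 0] R by simp
    moreover have "(\<lambda>n. \<phi> n * 0 ^ n) sums \<phi> 0" by (rule powser_sums_zero)
    ultimately show ?thesis by (rule sums_unique2)
  qed
  note nth = formal_substitution_nth[of a \<alpha> b \<beta> c \<gamma>, OF at0[OF abc(1)] at0[OF abc(2)] at0[OF abc(3)]]
  have formal: "formal_substitution \<alpha> \<beta> \<gamma> r d = 0"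
  proof (rule fps_ext)
    show "fps_nth (formal_substitution \<alpha> \<beta> \<gamma> r d) n = fps_nth 0 n" for n
      using rec[of n] root by (cases "n = 0") (auto simp: nth)
  qed
  have unique: "e = d" if e: "e 0 = 1" "formal_substitution \<alpha> \<beta> \<gamma> r e = 0" for e
  proof
    show "e n = d n" for n
    proof (induction n rule: less_induct)
      case (less n)
      show ?case
      proof (cases "n = 0")
        case False
        have "?Q n * e n + (\<Sum>k<n. ?T n k * e k) = 0"
          using nth[of r e n] e(2) by simp
        moreover have "(\<Sum>k<n. ?T n k * e k) = (\<Sum>k<n. ?T n k * d k)"
          by (intro sum.cong) (auto simp: less.IH)
        ultimately have "?Q n * e n = - (\<Sum>k<n. ?T n k * d k)"
          by (simp add: eq_neg_iff_add_eq_0)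
        then have "?Q n * e n = ?Q n * d n"
          using rec[of n] False by simp
        then show ?thesis using nonres[of n] False by simp
      qed (simp add: d0 e)
    qed
  qed
  have rad: "ereal R \<le> conv_radius d"
    by (rule conv_radius_recursion[OF rec indicial_growth[OF q] frob_term_bound[OF abc]])
  then have rad': "ereal R \<le> fps_conv_radius (Abs_fps d)"
    by (simp add: fps_conv_radius_def)
  show ?thesis
    by (rule that[OF d0 rad' frobenius_is_solution[OF abc rad' formal]])
       (use unique formal in \<open>auto simp: obtained_by_substitution_def\<close>)
qed

section \<open>Linear independence\<close>

text \<open>Differentiate the relation and multiply by \<open>x\<close>. The new relation has the
  same shape and the same \<open>u\<close>, \<open>v\<close>, \<open>w\<close>, so the step can be
  iterated.\<close>

lemma frobenius_relation_euler:
  assumes rads: "ereal R \<le> fps_conv_radius (Abs_fps e1)" "ereal R \<le> fps_conv_radius (Abs_fps e2)"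
      "ereal R \<le> fps_conv_radius (Abs_fps e3)"
    and rel: "\<And>x. x \<in> punctured R \<Longrightarrow>
      u * frobenius_fun r1 e1 x + v * frobenius_fun r2 e2 x + w * frobenius_fun r3 e3 x = 0"
    and x: "x \<in> punctured R"
  shows "u * frobenius_fun r1 (euler r1 e1) x + v * frobenius_fun r2 (euler r2 e2) x
       + w * frobenius_fun r3 (euler r3 e3) x = 0"
proof -
  have x': "x \<noteq> 0" "\<bar>x\<bar> < R" using x by (auto simp: punctured_def)
  have less: "ereal \<bar>x\<bar> < fps_conv_radius f" if "ereal R \<le> fps_conv_radius f" for f :: "complex fps"
    using x' that by (intro less_le_trans[OF _ that]) auto
  note D = frobenius_fun_has_vector_derivative[OF x'(1) less, where k = 0, simplified]
  let ?h = "\<lambda>x. u * frobenius_fun r1 e1 x + v * frobenius_fun r2 e2 x + w * frobenius_fun r3 e3 x"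
  have 1: "(?h has_vector_derivative
     (u * (frobenius_fun r1 (euler r1 e1) x / of_real x) + v * (frobenius_fun r2 (euler r2 e2) x / of_real x)
       + w * (frobenius_fun r3 (euler r3 e3) x / of_real x))) (at x)"
    by (intro has_vector_derivative_add has_vector_derivative_mult_right D rads)
  \<comment> \<open>The relation holds on an open set, so its left-hand side has derivative 0 at
    \<open>x\<close>; uniqueness of derivatives then compares the two.\<close>
  have "punctured R = ball 0 R - {0}" by (auto simp: punctured_def)
  then have "open (punctured R)" by (metis open_ball open_delete)
  then have 2: "(?h has_vector_derivative 0) (at x)"
    by (rule has_vector_derivative_transform_within_open[OF has_vector_derivative_const[of 0] _ x])
       (simp add: rel)
  from vector_derivative_unique_at[OF 1 2] x'(1) show ?thesis
    by (simp add: field_simps)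
qed

text \<open>Combining the equations with cofactors multiplies each unknown by the determinant, here
  expanded along the first row.\<close>

lemma cramer3:
  fixes u v w :: complex
  assumes "a1 * u + b1 * v + c1 * w = 0" "a2 * u + b2 * v + c2 * w = 0" "a3 * u + b3 * v + c3 * w = 0"
    and "a1 * (b2 * c3 - b3 * c2) - b1 * (a2 * c3 - a3 * c2) + c1 * (a2 * b3 - a3 * b2) \<noteq> 0"
      (is "?D \<noteq> 0")
  shows "u = 0 \<and> v = 0 \<and> w = 0"
proof -
  have "?D * u = 0" "?D * v = 0" "?D * w = 0" using assms(1-3) by algebra+
  then show ?thesis using assms(4) by simp
qed

text \<open>The prefactors |x|^r are absorbed into the unknowns of the linear system; the remaining
  matrix consists of power series, which are continuous at 0.\<close>

lemma frobenius_linearly_independent: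
  assumes R: "R > 0"
    and rads: "ereal R \<le> fps_conv_radius (Abs_fps e1)" "ereal R \<le> fps_conv_radius (Abs_fps e2)"
      "ereal R \<le> fps_conv_radius (Abs_fps e3)"
    and init: "e1 0 = 1" "e2 0 = 1" "e3 0 = 1"
    and distinct: "r1 \<noteq> r2" "r1 \<noteq> r3" "r2 \<noteq> r3"
  shows "linearly_independent3_on (punctured R)
           (frobenius_fun r1 e1) (frobenius_fun r2 e2) (frobenius_fun r3 e3)"
  unfolding linearly_independent3_on_def
proof (intro allI impI)
  fix u v w :: complex
  assume "\<forall>x\<in>punctured R.
      u * frobenius_fun r1 e1 x + v * frobenius_fun r2 e2 x + w * frobenius_fun r3 e3 x = 0"
  then have rel0: "\<And>x. x \<in> punctured R \<Longrightarrow>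
      u * frobenius_fun r1 e1 x + v * frobenius_fun r2 e2 x + w * frobenius_fun r3 e3 x = 0" by blast
  note rads' = rads[THEN euler_conv_radius]
  have rel1: "u * frobenius_fun r1 (euler r1 e1) x + v * frobenius_fun r2 (euler r2 e2) x
      + w * frobenius_fun r3 (euler r3 e3) x = 0" if "x \<in> punctured R" for x
    by (rule frobenius_relation_euler[OF rads rel0 that])
  have rel2: "u * frobenius_fun r1 (euler r1 (euler r1 e1)) x + v * frobenius_fun r2 (euler r2 (euler r2 e2)) x
      + w * frobenius_fun r3 (euler r3 (euler r3 e3)) x = 0" if "x \<in> punctured R" for x
    by (rule frobenius_relation_euler[OF rads' rel1 that])
  define ev where "ev = (\<lambda>e (x::real). eval_fps (Abs_fps e) (complex_of_real x))"
  define D where "D = (\<lambda>x.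
     ev e1 x * (ev (euler r2 e2) x * ev (euler r3 (euler r3 e3)) x
                 - ev (euler r2 (euler r2 e2)) x * ev (euler r3 e3) x)
   - ev e2 x * (ev (euler r1 e1) x * ev (euler r3 (euler r3 e3)) x
                 - ev (euler r1 (euler r1 e1)) x * ev (euler r3 e3) x)
   + ev e3 x * (ev (euler r1 e1) x * ev (euler r2 (euler r2 e2)) x
                 - ev (euler r1 (euler r1 e1)) x * ev (euler r2 e2) x))"
  have cont: "isCont (ev e) 0" if "ereal R \<le> fps_conv_radius (Abs_fps e)" for e
  proof -
    have "ereal (norm (complex_of_real 0)) < fps_conv_radius (Abs_fps e)"
      using R by (intro less_le_trans[OF _ that]) simp
    then have 1: "isCont (eval_fps (Abs_fps e)) (complex_of_real 0)"
      by (rule DERIV_isCont[OF has_field_derivative_eval_fps])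
    have 2: "isCont complex_of_real 0" by (intro continuous_intros)
    show ?thesis unfolding ev_def by (rule isCont_o2[OF 2 1])
  qed
  have "isCont D 0"
    unfolding D_def by (intro isCont_diff isCont_add isCont_mult cont rads rads' rads'[THEN euler_conv_radius])
  \<comment> \<open>At 0 the series have value 1 and each Euler step multiplies by the exponent, so
    the columns are (1, r, r^2).\<close>
  moreover have "D 0 = (r2 - r1) * (r3 - r1) * (r3 - r2)"
    by (simp add: D_def ev_def eval_fps_at_0 euler_def init algebra_simps)
  then have "D 0 \<noteq> 0" using distinct by simp
  \<comment> \<open>The relation is available only off 0, so the nonzero determinant is moved to a
    nearby point of the punctured interval.\<close>
  ultimately have "eventually (\<lambda>x. D x \<noteq> 0) (at 0)"
    by (simp add: isCont_def tendsto_imp_eventually_ne)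
  moreover have "eventually (\<lambda>x. x \<in> punctured R) (at 0)"
    unfolding eventually_at using R by (intro exI[of _ R]) (auto simp: punctured_def)
  ultimately have "eventually (\<lambda>x. D x \<noteq> 0 \<and> x \<in> punctured R) (at (0::real))"
    by (rule eventually_conj)
  then obtain x where x: "D x \<noteq> 0" "x \<in> punctured R"
    using eventually_happens[of _ "at (0::real)"] by auto
  have x0: "x \<noteq> 0" using x by (auto simp: punctured_def)
  define P where "P = (\<lambda>r. complex_of_real \<bar>x\<bar> powr r)"
  have factor: "u * frobenius_fun r1 f1 x + v * frobenius_fun r2 f2 x + w * frobenius_fun r3 f3 x
      = ev f1 x * (u * P r1) + ev f2 x * (v * P r2) + ev f3 x * (w * P r3)" for f1 f2 f3
    by (simp add: frobenius_fun_eval_fps ev_def P_def)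
  have "u * P r1 = 0 \<and> v * P r2 = 0 \<and> w * P r3 = 0"
    using rel0[OF x(2)] rel1[OF x(2)] rel2[OF x(2)] x(1)
    unfolding factor D_def by (rule cramer3)
  then show "u = 0 \<and> v = 0 \<and> w = 0" using x0 by (simp add: P_def)
qed

section \<open>The solutions belonging to the three exponents\<close>

theorem theorem6:
  fixes R :: real and a b c :: "real \<Rightarrow> real" and \<alpha> \<beta> \<gamma> :: "nat \<Rightarrow> real"
    and r1 r2 r3 :: complex
  assumes "R > 0"
    and "has_power_series_on R a \<alpha>"
    and "has_power_series_on R b \<beta>"
    and "has_power_series_on R c \<gamma>"
    and "proots (indicial_poly a b c) = {#r1, r2, r3#}"
    and "Re r1 \<ge> Re r2" and "Re r2 \<ge> Re r3"
  shows "\<exists>d. d 0 = 1 \<and>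
      (\<forall>x. \<bar>x\<bar> < R \<longrightarrow> summable (\<lambda>n. d n * complex_of_real x ^ n)) \<and>
      is_solution R a b c (frobenius_fun r1 d) \<and>
      obtained_by_substitution \<alpha> \<beta> \<gamma> r1 d \<and>
      (r1 - r2 \<notin> \<nat> \<and> r1 - r3 \<notin> \<nat> \<and> r2 - r3 \<notin> \<nat> \<longrightarrow>
        (\<exists>d' d''. d' 0 = 1 \<and> d'' 0 = 1 \<and>
          (\<forall>x. \<bar>x\<bar> < R \<longrightarrow> summable (\<lambda>n. d' n * complex_of_real x ^ n)) \<and>
          (\<forall>x. \<bar>x\<bar> < R \<longrightarrow> summable (\<lambda>n. d'' n * complex_of_real x ^ n)) \<and>
          is_solution R a b c (frobenius_fun r2 d') \<and>
          is_solution R a b c (frobenius_fun r3 d'') \<and>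
          obtained_by_substitution \<alpha> \<beta> \<gamma> r2 d' \<and>
          obtained_by_substitution \<alpha> \<beta> \<gamma> r3 d'' \<and>
          linearly_independent3_on (punctured R)
            (frobenius_fun r1 d) (frobenius_fun r2 d') (frobenius_fun r3 d'')))"
proof -
  note q = indicial_poly_factor[OF assms(5)]
  note series = frobenius_series[OF assms(2-4,1) q]
  have root: "poly (indicial_poly a b c) r1 = 0" "poly (indicial_poly a b c) r2 = 0"
    "poly (indicial_poly a b c) r3 = 0"
    by (auto simp: q)
  have conv: "\<forall>x. \<bar>x\<bar> < R \<longrightarrow> summable (\<lambda>n. d n * complex_of_real x ^ n)"
    if "ereal R \<le> fps_conv_radius (Abs_fps d)" for d
  proof (intro allI impI)
    fix x assume "\<bar>x\<bar> < R"
    then have "ereal (norm (complex_of_real x)) < fps_conv_radius (Abs_fps d)"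
      by (intro less_le_trans[OF _ that]) auto
    from summable_fps[OF this] show "summable (\<lambda>n. d n * complex_of_real x ^ n)" by simp
  qed
  \<comment> \<open>Adding a positive integer raises the real part, so no root with equal or smaller
    real part is reached.\<close>
  have lower: "r + of_nat n \<noteq> s" if "Re s \<le> Re r" "n > 0" for r s :: complex and n
  proof
    assume "r + of_nat n = s"
    then have "Re r + real n = Re s" by auto
    then show False using that by simp
  qed
  \<comment> \<open>Reaching \<open>s\<close> would make \<open>s - r\<close> a natural
    number.\<close>
  have upper: "r + of_nat n \<noteq> s" if "s - r \<notin> \<nat>" for r s :: complex and n
    using that by (metis add_diff_cancel_left' of_nat_in_Nats)
  have nz1: "poly (indicial_poly a b c) (r1 + of_nat n) \<noteq> 0" if "n > 0" for n
    using lower[of r1 r1 n] lower[of r2 r1 n] lower[of r3 r1 n] that assms(6,7) by (auto simp: q)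
  obtain d where d: "d 0 = 1" "ereal R \<le> fps_conv_radius (Abs_fps d)"
    "is_solution R a b c (frobenius_fun r1 d)" "obtained_by_substitution \<alpha> \<beta> \<gamma> r1 d"
    using series[OF root(1) nz1] by blast
  have remaining: "\<exists>d' d''. d' 0 = 1 \<and> d'' 0 = 1 \<and>
          (\<forall>x. \<bar>x\<bar> < R \<longrightarrow> summable (\<lambda>n. d' n * complex_of_real x ^ n)) \<and>
          (\<forall>x. \<bar>x\<bar> < R \<longrightarrow> summable (\<lambda>n. d'' n * complex_of_real x ^ n)) \<and>
          is_solution R a b c (frobenius_fun r2 d') \<and>
          is_solution R a b c (frobenius_fun r3 d'') \<and>
          obtained_by_substitution \<alpha> \<beta> \<gamma> r2 d' \<and>
          obtained_by_substitution \<alpha> \<beta> \<gamma> r3 d'' \<and>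
          linearly_independent3_on (punctured R)
            (frobenius_fun r1 d) (frobenius_fun r2 d') (frobenius_fun r3 d'')"
    if nonres: "r1 - r2 \<notin> \<nat>" "r1 - r3 \<notin> \<nat>" "r2 - r3 \<notin> \<nat>"
  proof -
    \<comment> \<open>The factor of \<open>r1\<close> is excluded by non-resonance, those of
      \<open>r2\<close> and \<open>r3\<close> by their real parts.\<close>
    have nz2: "poly (indicial_poly a b c) (r2 + of_nat n) \<noteq> 0" if "n > 0" for n
      using upper[OF nonres(1), of n] lower[of r2 r2 n] lower[of r3 r2 n] that assms(7)
      by (auto simp: q)
    have nz3: "poly (indicial_poly a b c) (r3 + of_nat n) \<noteq> 0" if "n > 0" for n
      using upper[OF nonres(2), of n] upper[OF nonres(3), of n] lower[of r3 r3 n] that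
      by (auto simp: q)
    obtain d' where d': "d' 0 = 1" "ereal R \<le> fps_conv_radius (Abs_fps d')"
      "is_solution R a b c (frobenius_fun r2 d')" "obtained_by_substitution \<alpha> \<beta> \<gamma> r2 d'"
      using series[OF root(2) nz2] by blast
    obtain d'' where d'': "d'' 0 = 1" "ereal R \<le> fps_conv_radius (Abs_fps d'')"
      "is_solution R a b c (frobenius_fun r3 d'')" "obtained_by_substitution \<alpha> \<beta> \<gamma> r3 d''"
      using series[OF root(3) nz3] by blast
    \<comment> \<open>Zero is a natural number, so non-resonance includes distinctness.\<close>
    have "r1 \<noteq> r2" "r1 \<noteq> r3" "r2 \<noteq> r3" using nonres by auto
    then have "linearly_independent3_on (punctured R)
            (frobenius_fun r1 d) (frobenius_fun r2 d') (frobenius_fun r3 d'')"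
      by (intro frobenius_linearly_independent assms(1) d d' d'')
    then show ?thesis
      by (intro exI[of _ d'] exI[of _ d''] conjI d' d'' conv)
  qed
  show ?thesis
    by (rule exI[of _ d], intro conjI impI d conv, elim conjE, rule remaining)
qed

end
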